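(* Let $Q$ be a complete normed linear space, let $P\subseteq Q$ be nonempty, closed and convex, and let $R:P\to P$ be a weak contraction with constants $\zeta\in(0,1)$ and $L\ge 0$, that is, $$\|Rp-Rq\|\le \zeta\|p-q\|+L\|q-Rp\|\quad\text{for all }p,q\in P,$$ which in addition satisfies $$\|Rp-Rq\|\le \zeta\|p-q\|+L\|p-Rp\|\quad\text{for all }p,q\in P.$$ Let $F:P\to P$ be an approximate operator of $R$ with fixed $\epsilon>0$, i.e. $\|Fp-Rp\|\le\epsilon$ for all $p\in P$. Let $(a_m)_{m\ge0}$ be a sequence in $(0,1)$ with $a_m\ge\frac12$ for all $m\in\mathbb{Z}_+$ and $\sum_{m=0}^\infty a_m=\infty$. Let $\{s_m\}$ be the sequence generated from some $s_0\in P$ by the $AT$ iterative algorithm for $R$ with control sequence $(a_m)$, and let $\{v_m\}$ be the sequence defined by $v_0=v\in P$ and, for $m\in\mathbb{Z}_+$, $$g_m=\tfrac12\Big[F^2\big((1-a_m)v_m+a_mFv_m\big)+F^2v_m\Big],\qquad v_{m+1}=F\big((1-a_m)g_m+a_mFg_m\big).$$ If $Rs=s$ and $Ft=t$ with $s,t\in P$, and $v_m\to t$ as $m\to\infty$, then $$\|s-t\|\le\frac{5\epsilon+2\zeta\epsilon+\zeta^2\epsilon}{1-\zeta}.$$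
   Context: $\mathbb{Z}_+$ denotes the set of nonnegative integers; $R^2=R\circ R$ and $F^2=F\circ F$. The $AT$ iterative algorithm for a self-map $R$ of $P$, with control sequence $(a_m)$ in $(0,1)$ and initial point $s_0\in P$, is defined for $m\in\mathbb{Z}_+$ by $$b_m=\tfrac12 R^2(s_m)+\tfrac12 R^2\big((1-a_m)s_m+a_mRs_m\big),\qquad s_{m+1}=R\big((1-a_m)b_m+a_mRb_m\big).$$ *)

theory Defs
  imports "HOL-Analysis.Analysis"
begin

text \<open>Self-maps of a subset \<open>P\<close> are total functions on the ambient type that map \<open>P\<close> into \<open>P\<close>;
  their values outside \<open>P\<close> are never constrained.\<close>

definition weak_contraction_on ::
    "'a::real_normed_vector set \<Rightarrow> real \<Rightarrow> real \<Rightarrow> ('a \<Rightarrow> 'a) \<Rightarrow> bool" where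
  "weak_contraction_on P \<zeta> L R \<longleftrightarrow>
     R ` P \<subseteq> P \<and> 0 < \<zeta> \<and> \<zeta> < 1 \<and> 0 \<le> L \<and>
     (\<forall>p\<in>P. \<forall>q\<in>P. norm (R p - R q) \<le> \<zeta> * norm (p - q) + L * norm (q - R p))"

definition approximate_operator_on ::
    "'a::real_normed_vector set \<Rightarrow> real \<Rightarrow> ('a \<Rightarrow> 'a) \<Rightarrow> ('a \<Rightarrow> 'a) \<Rightarrow> bool" where
  "approximate_operator_on P \<epsilon> R F \<longleftrightarrow>
     F ` P \<subseteq> P \<and> 0 < \<epsilon> \<and> (\<forall>p\<in>P. norm (F p - R p) \<le> \<epsilon>)"

definition AT_sequence ::
    "'a::real_normed_vector set \<Rightarrow> ('a \<Rightarrow> 'a) \<Rightarrow> (nat \<Rightarrow> real) \<Rightarrow> (nat \<Rightarrow> 'a) \<Rightarrow> bool" where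
  "AT_sequence P R a x \<longleftrightarrow>
     x 0 \<in> P \<and>
     (\<forall>m. let b = (1/2) *\<^sub>R (R ^^ 2) (x m)
                + (1/2) *\<^sub>R (R ^^ 2) ((1 - a m) *\<^sub>R x m + a m *\<^sub>R R (x m))
          in x (Suc m) = R ((1 - a m) *\<^sub>R b + a m *\<^sub>R R b))"

end

theory Submission
  imports Defs
begin

text \<open>
  The bound compares the two fixed points directly. At a fixed point \<open>s\<close> of \<open>R\<close> the
  displacement \<open>p - R p\<close> in the second contraction inequality vanishes, so \<open>R\<close> contracts
  distances measured from \<open>s\<close> by the factor \<open>\<zeta>\<close>. A fixed point \<open>t\<close> of \<open>F\<close> is moved by \<open>R\<close>
  by at most \<open>\<epsilon>\<close>. Hence \<open>\<parallel>s - t\<parallel> \<le> \<zeta> \<parallel>s - t\<parallel> + \<epsilon>\<close>, which gives \<open>\<parallel>s - t\<parallel> \<le> \<epsilon> / (1 - \<zeta>)\<close>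
  (\<open>fixed_point_approximate_fixed_point_distance\<close>), and
  \<open>\<epsilon> \<le> 5 \<epsilon> + 2 \<zeta> \<epsilon> + \<zeta>\<^sup>2 \<epsilon>\<close>.
\<close>

text \<open>
  This is the a posteriori estimate of the Banach fixed point theorem: going from \<open>s = R s\<close>
  to \<open>t\<close> through \<open>R t\<close> puts \<open>\<parallel>s - t\<parallel>\<close> on both sides, and \<open>\<zeta> < 1\<close> lets it be absorbed on
  the left.
\<close>

lemma fixed_point_approximate_fixed_point_distance:
  fixes R :: "'a::real_normed_vector \<Rightarrow> 'a"
  assumes "\<zeta> < 1"
    and contr: "norm (R s - R t) \<le> \<zeta> * norm (s - t)"
    and fixed: "R s = s"
    and approx: "norm (t - R t) \<le> \<epsilon>"
  shows "norm (s - t) \<le> \<epsilon> / (1 - \<zeta>)"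
proof -
  have "norm (s - t) \<le> norm (R s - R t) + norm (R t - t)"
    using norm_triangle_ineq[of "R s - R t" "R t - t"] fixed by simp
  also have "\<dots> \<le> \<zeta> * norm (s - t) + \<epsilon>"
    using contr approx by (simp add: norm_minus_commute)
  finally have "(1 - \<zeta>) * norm (s - t) \<le> \<epsilon>"
    by (simp add: algebra_simps)
  then show ?thesis
    using \<open>\<zeta> < 1\<close> by (simp add: pos_le_divide_eq mult.commute)
qed

theorem theorem5:
  fixes P :: "'a::banach set"
    and R F :: "'a \<Rightarrow> 'a"
    and \<zeta> L \<epsilon> :: real
    and a :: "nat \<Rightarrow> real"
    and s_seq v_seq g_seq :: "nat \<Rightarrow> 'a"
    and s t v :: 'a
  assumes P: "P \<noteq> {}" "closed P" "convex P"
    and R: "weak_contraction_on P \<zeta> L R"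
    and R': "\<forall>p\<in>P. \<forall>q\<in>P. norm (R p - R q) \<le> \<zeta> * norm (p - q) + L * norm (p - R p)"
    and F: "approximate_operator_on P \<epsilon> R F"
    and a_range: "\<forall>m. 0 < a m \<and> a m < 1"
    and a_half: "\<forall>m. a m \<ge> 1/2"
    and a_div: "filterlim (\<lambda>n. \<Sum>m<n. a m) at_top sequentially"
    and s_seq: "AT_sequence P R a s_seq"
    and v_init: "v \<in> P" "v_seq 0 = v"
    and g_seq: "\<forall>m. g_seq m =
          (1/2) *\<^sub>R ((F ^^ 2) ((1 - a m) *\<^sub>R v_seq m + a m *\<^sub>R F (v_seq m)) + (F ^^ 2) (v_seq m))"
    and v_seq: "\<forall>m. v_seq (Suc m) = F ((1 - a m) *\<^sub>R g_seq m + a m *\<^sub>R F (g_seq m))"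
    and s: "s \<in> P" "R s = s"
    and t: "t \<in> P" "F t = t"
    and v_lim: "v_seq \<longlonglongrightarrow> t"
  shows "norm (s - t) \<le> (5 * \<epsilon> + 2 * \<zeta> * \<epsilon> + \<zeta>\<^sup>2 * \<epsilon>) / (1 - \<zeta>)"
proof -
  have \<zeta>: "0 < \<zeta>" "\<zeta> < 1"
    using R by (auto simp: weak_contraction_on_def)
  have "0 < \<epsilon>" and "norm (F t - R t) \<le> \<epsilon>"
    using F t(1) by (auto simp: approximate_operator_on_def)
  then have approx: "norm (t - R t) \<le> \<epsilon>"
    using t(2) by simp
  have "norm (R s - R t) \<le> \<zeta> * norm (s - t) + L * norm (s - R s)"
    using R' s(1) t(1) by blast
  then have "norm (R s - R t) \<le> \<zeta> * norm (s - t)"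
    using s(2) by simp
  then have "norm (s - t) \<le> \<epsilon> / (1 - \<zeta>)"
    using fixed_point_approximate_fixed_point_distance \<zeta>(2) s(2) approx by blast
  also have "\<dots> \<le> (5 * \<epsilon> + 2 * \<zeta> * \<epsilon> + \<zeta>\<^sup>2 * \<epsilon>) / (1 - \<zeta>)"
  proof (rule divide_right_mono)
    have "0 \<le> 2 * \<zeta> * \<epsilon>" and "0 \<le> \<zeta>\<^sup>2 * \<epsilon>"
      using \<zeta>(1) \<open>0 < \<epsilon>\<close> by simp_all
    then show "\<epsilon> \<le> 5 * \<epsilon> + 2 * \<zeta> * \<epsilon> + \<zeta>\<^sup>2 * \<epsilon>"
      using \<open>0 < \<epsilon>\<close> by linarith
  qed (use \<zeta>(2) in simp)
  finally show ?thesis .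
qed

end
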